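(* Let $(\bar d,\bar\delta,\bar\beta,\bar\gamma,\bar\mu)$ be optimal for the Lagrangian relaxation (LR-$\Delta$) and let $d^*$ be optimal for (OG-TR-IP). If $\Delta\ge\sum_{i=1}^N\sum_{j=1}^M\bar\delta_{i,j}\ge p\Delta$ for some $p\in(0,1]$, then $$c^T\bar d+\omega(\bar d)-\bar C\ \le\ p\,\bigl(c^Td^*+\omega(d^* )-\bar C\bigr).$$
   Context: Setting: $N,M\in\mathbb{N}$, $[N]:=\{1,\dots,N\}$, $\Xi\subset\mathbb{Z}$ is a finite contiguous set of integers, $x\in\Xi^{N\times M}$, $c\in\mathbb{R}^{N\times M}$, $\alpha>0$, $\Delta\in\mathbb{N}$. Write $c^Td:=\sum_{i=1}^N\sum_{j=1}^Mc_{i,j}d_{i,j}$, $$\omega(d):=\alpha\sum_{j=1}^M\sum_{i=1}^{N-1}|x_{i+1,j}+d_{i+1,j}-x_{i,j}-d_{i,j}|+\alpha\sum_{i=1}^N\sum_{j=1}^{M-1}|x_{i,j+1}+d_{i,j+1}-x_{i,j}-d_{i,j}|,$$ $$\bar C:=\alpha\sum_{j=1}^M\sum_{i=1}^{N-1}|x_{i+1,j}-x_{i,j}|+\alpha\sum_{i=1}^N\sum_{j=1}^{M-1}|x_{i,j+1}-x_{i,j}|.$$ (OG-TR-IP): minimize $c^Td+\omega(d)-\bar C$ over $d\in\mathbb{Z}^{N\times M}$ subject to $x_{i,j}+d_{i,j}\in\Xi$ for all $i\in[N],j\in[M]$ and $\sum_{i,j}|d_{i,j}|\le\Delta$. The polyhedron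 $P$ is the set of all real tuples $(d,\delta,\beta,\gamma)$, $d,\delta\in\mathbb{R}^{N\times M}$, $\beta\in\mathbb{R}^{(N-1)\times M}$, $\gamma\in\mathbb{R}^{N\times(M-1)}$, with - $\min\Xi\le x_{i,j}+d_{i,j}\le\max\Xi$ for $i\in[N],j\in[M]$; - $-\beta_{i,j}\le x_{i+1,j}+d_{i+1,j}-x_{i,j}-d_{i,j}\le\beta_{i,j}$ for $i\in[N-1],j\in[M]$; - $-\gamma_{i,j}\le x_{i,j+1}+d_{i,j+1}-x_{i,j}-d_{i,j}\le\gamma_{i,j}$ for $i\in[N],j\in[M-1]$; - $-\delta_{i,j}\le d_{i,j}\le\delta_{i,j}$ for $i\in[N],j\in[M]$. (LR-$\Delta$): $$\max_{\mu\ge0}\ \min_{(d,\delta,\beta,\gamma)\in P,\ d\in\mathbb{Z}^{N\times M}}\ \sum_{i,j}c_{i,j}d_{i,j}+\alpha\Bigl(\sum_{j=1}^M\sum_{i=1}^{N-1}\beta_{i,j}+\sum_{i=1}^N\sum_{j=1}^{M-1}\gamma_{i,j}\Bigr)+\mu\Bigl(\sum_{i=1}^N\sum_{j=1}^M\delta_{i,j}-\Delta\Bigr).$$ A tuple $(\bar d,\bar\delta,\bar\beta,\bar\gamma,\bar\mu)$ is optimal for (LR-$\Delta$) if $\bar\mu\ge0$ attains the outer maximum and $(\bar d,\bar\delta,\bar\beta,\bar\gamma)$ attains the inner minimum for $\mu=\bar\mu$. *)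

theory Defs
  imports Complex_Main "HOL-Library.FuncSet"
begin

text \<open>
  An \<open>N \<times> M\<close> matrix is a function \<open>nat \<Rightarrow> nat \<Rightarrow> _\<close> that is only ever inspected at the
  index pairs \<open>(i, j)\<close> with \<open>1 \<le> i \<le> N\<close> and \<open>1 \<le> j \<le> M\<close>. No constraint or objective
  below depends on the other values.
\<close>

type_synonym mat = "nat \<Rightarrow> nat \<Rightarrow> real"

definition contiguous :: "int set \<Rightarrow> bool" where
  "contiguous \<Xi> \<longleftrightarrow> (\<forall>k\<in>\<Xi>. \<forall>l\<in>\<Xi>. {k..l} \<subseteq> \<Xi>)"

definition mat_inner :: "nat \<Rightarrow> nat \<Rightarrow> mat \<Rightarrow> mat \<Rightarrow> real" where
  "mat_inner N M c d = (\<Sum>i=1..N. \<Sum>j=1..M. c i j * d i j)"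

definition omega :: "nat \<Rightarrow> nat \<Rightarrow> (nat \<Rightarrow> nat \<Rightarrow> int) \<Rightarrow> real \<Rightarrow> mat \<Rightarrow> real" where
  "omega N M x \<alpha> d =
     \<alpha> * (\<Sum>j=1..M. \<Sum>i=1..N-1. \<bar>x (i+1) j + d (i+1) j - x i j - d i j\<bar>) +
     \<alpha> * (\<Sum>i=1..N. \<Sum>j=1..M-1. \<bar>x i (j+1) + d i (j+1) - x i j - d i j\<bar>)"

definition C_bar :: "nat \<Rightarrow> nat \<Rightarrow> (nat \<Rightarrow> nat \<Rightarrow> int) \<Rightarrow> real \<Rightarrow> real" where
  "C_bar N M x \<alpha> =
     \<alpha> * (\<Sum>j=1..M. \<Sum>i=1..N-1. \<bar>real_of_int (x (i+1) j) - real_of_int (x i j)\<bar>) +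
     \<alpha> * (\<Sum>i=1..N. \<Sum>j=1..M-1. \<bar>real_of_int (x i (j+1)) - real_of_int (x i j)\<bar>)"

definition og_objective ::
  "nat \<Rightarrow> nat \<Rightarrow> (nat \<Rightarrow> nat \<Rightarrow> int) \<Rightarrow> mat \<Rightarrow> real \<Rightarrow> mat \<Rightarrow> real" where
  "og_objective N M x c \<alpha> d = mat_inner N M c d + omega N M x \<alpha> d - C_bar N M x \<alpha>"

definition integral_mat :: "nat \<Rightarrow> nat \<Rightarrow> mat \<Rightarrow> bool" where
  "integral_mat N M d \<longleftrightarrow> (\<forall>i\<in>{1..N}. \<forall>j\<in>{1..M}. d i j \<in> \<int>)"

definition og_feasible ::
  "nat \<Rightarrow> nat \<Rightarrow> int set \<Rightarrow> (nat \<Rightarrow> nat \<Rightarrow> int) \<Rightarrow> nat \<Rightarrow> mat \<Rightarrow> bool" where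
  "og_feasible N M \<Xi> x \<Delta> d \<longleftrightarrow>
     integral_mat N M d \<and>
     (\<forall>i\<in>{1..N}. \<forall>j\<in>{1..M}. x i j + d i j \<in> real_of_int ` \<Xi>) \<and>
     (\<Sum>i=1..N. \<Sum>j=1..M. \<bar>d i j\<bar>) \<le> \<Delta>"

definition og_optimal ::
  "nat \<Rightarrow> nat \<Rightarrow> int set \<Rightarrow> (nat \<Rightarrow> nat \<Rightarrow> int) \<Rightarrow> mat \<Rightarrow> real \<Rightarrow> nat \<Rightarrow> mat \<Rightarrow> bool" where
  "og_optimal N M \<Xi> x c \<alpha> \<Delta> d \<longleftrightarrow>
     is_arg_min (og_objective N M x c \<alpha>) (og_feasible N M \<Xi> x \<Delta>) d"

definition P_poly ::
  "nat \<Rightarrow> nat \<Rightarrow> int set \<Rightarrow> (nat \<Rightarrow> nat \<Rightarrow> int) \<Rightarrow> (mat \<times> mat \<times> mat \<times> mat) set" where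
  "P_poly N M \<Xi> x = {(d, \<delta>, \<beta>, \<gamma>).
     (\<forall>i\<in>{1..N}. \<forall>j\<in>{1..M}. Min \<Xi> \<le> x i j + d i j \<and> x i j + d i j \<le> Max \<Xi>) \<and>
     (\<forall>i\<in>{1..N-1}. \<forall>j\<in>{1..M}.
        - \<beta> i j \<le> x (i+1) j + d (i+1) j - x i j - d i j \<and>
        x (i+1) j + d (i+1) j - x i j - d i j \<le> \<beta> i j) \<and>
     (\<forall>i\<in>{1..N}. \<forall>j\<in>{1..M-1}.
        - \<gamma> i j \<le> x i (j+1) + d i (j+1) - x i j - d i j \<and>
        x i (j+1) + d i (j+1) - x i j - d i j \<le> \<gamma> i j) \<and>
     (\<forall>i\<in>{1..N}. \<forall>j\<in>{1..M}. - \<delta> i j \<le> d i j \<and> d i j \<le> \<delta> i j)}"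

definition lr_feasible ::
  "nat \<Rightarrow> nat \<Rightarrow> int set \<Rightarrow> (nat \<Rightarrow> nat \<Rightarrow> int) \<Rightarrow> (mat \<times> mat \<times> mat \<times> mat) set" where
  "lr_feasible N M \<Xi> x = {(d, \<delta>, \<beta>, \<gamma>). (d, \<delta>, \<beta>, \<gamma>) \<in> P_poly N M \<Xi> x \<and> integral_mat N M d}"

definition lagrangian ::
  "nat \<Rightarrow> nat \<Rightarrow> mat \<Rightarrow> real \<Rightarrow> nat \<Rightarrow> real \<Rightarrow> mat \<times> mat \<times> mat \<times> mat \<Rightarrow> real" where
  "lagrangian N M c \<alpha> \<Delta> \<mu> = (\<lambda>(d, \<delta>, \<beta>, \<gamma>).
     (\<Sum>i=1..N. \<Sum>j=1..M. c i j * d i j) +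
     \<alpha> * ((\<Sum>j=1..M. \<Sum>i=1..N-1. \<beta> i j) + (\<Sum>i=1..N. \<Sum>j=1..M-1. \<gamma> i j)) +
     \<mu> * ((\<Sum>i=1..N. \<Sum>j=1..M. \<delta> i j) - \<Delta>))"

text \<open>
  The infimum below is a minimum for every \<open>\<mu> \<ge> 0\<close>; see \<open>lr_inner_min_attained\<close>.
\<close>

definition lr_inner_min ::
  "nat \<Rightarrow> nat \<Rightarrow> int set \<Rightarrow> (nat \<Rightarrow> nat \<Rightarrow> int) \<Rightarrow> mat \<Rightarrow> real \<Rightarrow> nat \<Rightarrow> real \<Rightarrow> real" where
  "lr_inner_min N M \<Xi> x c \<alpha> \<Delta> \<mu> = (INF t\<in>lr_feasible N M \<Xi> x. lagrangian N M c \<alpha> \<Delta> \<mu> t)"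

definition lr_optimal ::
  "nat \<Rightarrow> nat \<Rightarrow> int set \<Rightarrow> (nat \<Rightarrow> nat \<Rightarrow> int) \<Rightarrow> mat \<Rightarrow> real \<Rightarrow> nat \<Rightarrow>
     mat \<Rightarrow> mat \<Rightarrow> mat \<Rightarrow> mat \<Rightarrow> real \<Rightarrow> bool" where
  "lr_optimal N M \<Xi> x c \<alpha> \<Delta> d \<delta> \<beta> \<gamma> \<mu> \<longleftrightarrow>
     is_arg_max (lr_inner_min N M \<Xi> x c \<alpha> \<Delta>) (\<lambda>\<mu>'. \<mu>' \<ge> 0) \<mu> \<and>
     is_arg_min (lagrangian N M c \<alpha> \<Delta> \<mu>) (\<lambda>t. t \<in> lr_feasible N M \<Xi> x) (d, \<delta>, \<beta>, \<gamma>)"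

lemma lr_inner_min_attained:
  assumes fin: "finite \<Xi>" and x: "\<And>i j. i \<in> {1..N} \<Longrightarrow> j \<in> {1..M} \<Longrightarrow> x i j \<in> \<Xi>"
    and \<alpha>: "\<alpha> > 0" and \<mu>: "\<mu> \<ge> 0"
  obtains t where "is_arg_min (lagrangian N M c \<alpha> \<Delta> \<mu>) (\<lambda>t. t \<in> lr_feasible N M \<Xi> x) t"
    and "lagrangian N M c \<alpha> \<Delta> \<mu> t = lr_inner_min N M \<Xi> x c \<alpha> \<Delta> \<mu>"
proof -
  let ?L = "lagrangian N M c \<alpha> \<Delta> \<mu>" and ?S = "lr_feasible N M \<Xi> x"
  define T :: "mat \<Rightarrow> mat \<times> mat \<times> mat \<times> mat" where
    "T d = (d, \<lambda>i j. \<bar>d i j\<bar>,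
        \<lambda>i j. \<bar>x (i+1) j + d (i+1) j - x i j - d i j\<bar>,
        \<lambda>i j. \<bar>x i (j+1) + d i (j+1) - x i j - d i j\<bar>)" for d :: mat
  define D where "D = fst ` ?S"
  define r :: "mat \<Rightarrow> nat \<times> nat \<Rightarrow> real"
    where "r d = restrict (\<lambda>(i, j). d i j) ({1..N} \<times> {1..M})" for d
  define H where "H f = ?L (T (\<lambda>i j. f (i, j)))" for f
  have TS: "T d \<in> ?S" if "d \<in> D" for d
    using that by (auto simp: D_def T_def lr_feasible_def P_poly_def)
  have LT: "?L (T (fst t)) \<le> ?L t" if "t \<in> ?S" for t
  proof -
    obtain d \<delta> \<beta> \<gamma> where t: "t = (d, \<delta>, \<beta>, \<gamma>)" by (cases t)
    have P: "(d, \<delta>, \<beta>, \<gamma>) \<in> P_poly N M \<Xi> x" using that by (simp add: t lr_feasible_def)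
    have \<delta>: "\<bar>d i j\<bar> \<le> \<delta> i j" if "i \<in> {1..N}" "j \<in> {1..M}" for i j
    proof -
      have "- \<delta> i j \<le> d i j \<and> d i j \<le> \<delta> i j"
        using P that unfolding P_poly_def by blast
      then show ?thesis by linarith
    qed
    have \<beta>: "\<bar>x (i+1) j + d (i+1) j - x i j - d i j\<bar> \<le> \<beta> i j" if "i \<in> {1..N-1}" "j \<in> {1..M}" for i j
    proof -
      have "- \<beta> i j \<le> x (i+1) j + d (i+1) j - x i j - d i j \<and>
            x (i+1) j + d (i+1) j - x i j - d i j \<le> \<beta> i j"
        using P that unfolding P_poly_def by blast
      then show ?thesis by linarith
    qed
    have \<gamma>: "\<bar>x i (j+1) + d i (j+1) - x i j - d i j\<bar> \<le> \<gamma> i j" if "i \<in> {1..N}" "j \<in> {1..M-1}" for i j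
    proof -
      have "- \<gamma> i j \<le> x i (j+1) + d i (j+1) - x i j - d i j \<and>
            x i (j+1) + d i (j+1) - x i j - d i j \<le> \<gamma> i j"
        using P that unfolding P_poly_def by blast
      then show ?thesis by linarith
    qed
    show ?thesis
      unfolding t T_def lagrangian_def prod.case fst_conv
      by (intro add_mono mult_left_mono diff_mono sum_mono order_refl \<delta> \<beta> \<gamma> less_imp_le[OF \<alpha>] \<mu>)
  qed
  have H: "?L (T d) = H (r d)" for d
    unfolding H_def T_def r_def lagrangian_def prod.case
    by (intro arg_cong2[where f = "(+)"] arg_cong2[where f = "(*)"]
          arg_cong2[where f = "(-)"] refl sum.cong) auto
  have "r ` D \<subseteq> (\<Pi>\<^sub>E (i, j)\<in>{1..N} \<times> {1..M}. real_of_int ` {Min \<Xi> - x i j..Max \<Xi> - x i j})"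
  proof (clarsimp simp: PiE_iff r_def D_def lr_feasible_def P_poly_def integral_mat_def)
    fix d :: mat and i j
    assume "\<forall>i\<in>{Suc 0..N}. \<forall>j\<in>{Suc 0..M}. d i j \<in> \<int>"
      and b: "\<forall>i\<in>{Suc 0..N}. \<forall>j\<in>{Suc 0..M}. Min \<Xi> \<le> x i j + d i j \<and> x i j + d i j \<le> Max \<Xi>"
      and ij: "Suc 0 \<le> i" "i \<le> N" "Suc 0 \<le> j" "j \<le> M"
    then have "d i j \<in> \<int>" by auto
    then obtain k where k: "d i j = of_int k" by (rule Ints_cases)
    have "Min \<Xi> \<le> x i j + d i j" "x i j + d i j \<le> Max \<Xi>" using b ij by auto
    then have "k \<in> {Min \<Xi> - x i j..Max \<Xi> - x i j}" unfolding k by auto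
    then show "d i j \<in> real_of_int ` {Min \<Xi> - x i j..Max \<Xi> - x i j}" using k by blast
  qed
  moreover have "finite (\<Pi>\<^sub>E (i, j)\<in>{1..N} \<times> {1..M}. real_of_int ` {Min \<Xi> - x i j..Max \<Xi> - x i j})"
    by (rule finite_PiE) auto
  ultimately have "finite (r ` D)" by (rule finite_subset)
  then have finV: "finite ((\<lambda>d. ?L (T d)) ` D)" unfolding H by (simp add: image_image[symmetric])
  have "T (\<lambda>_ _. 0) \<in> ?S"
    using fin x by (auto simp: T_def lr_feasible_def P_poly_def integral_mat_def)
  then have "D \<noteq> {}" by (auto simp: D_def)
  then have "Min ((\<lambda>d. ?L (T d)) ` D) \<in> (\<lambda>d. ?L (T d)) ` D" using finV by (intro Min_in) auto
  then obtain d where d: "d \<in> D" and m: "?L (T d) = Min ((\<lambda>d. ?L (T d)) ` D)" by force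
  have le: "?L (T d) \<le> ?L t" if "t \<in> ?S" for t
  proof -
    have "?L (T d) \<le> ?L (T (fst t))" unfolding m using finV that by (intro Min_le) (auto simp: D_def)
    with LT[OF that] show ?thesis by simp
  qed
  show ?thesis
  proof
    show "is_arg_min ?L (\<lambda>t. t \<in> ?S) (T d)"
      using TS[OF d] le by (auto simp: is_arg_min_linorder)
    show "?L (T d) = lr_inner_min N M \<Xi> x c \<alpha> \<Delta> \<mu>"
      unfolding lr_inner_min_def
      by (rule sym, rule cInf_eq_minimum) (use TS[OF d] le in auto)
  qed
qed

end

theory Submission
  imports Defs
begin

text \<open>
  Write \<open>f d = c\<^sup>T d + \<omega>(d) - C\<close> for the objective and \<open>S\<close> for the sum of the \<open>\<delta>_bar i j\<close>.
  After minimising over the slack variables, the Lagrangian at multiplier \<open>\<mu>\<close> is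
  \<open>f d + C + \<mu> (\<bar>d\<bar> - \<Delta>)\<close>, where \<open>\<bar>d\<bar>\<close> is the entrywise 1-norm. Inner optimality therefore gives
  \<open>f d_bar + \<mu> S \<le> f d + \<mu> \<bar>d\<bar>\<close> for every integral \<open>d\<close> that keeps \<open>x + d\<close> within the bounds
  (lemma \<open>lagrangian_minimiser_bound\<close>). Two competitors suffice:

  \<^item> \<open>d = d_star\<close>, where \<open>\<bar>d_star\<bar> \<le> \<Delta>\<close>, yields \<open>f d_bar + \<mu> S \<le> f d_star + \<mu> \<Delta>\<close>;
  \<^item> \<open>d = 0\<close>, where \<open>f 0 = 0\<close>, yields \<open>f d_bar + \<mu> S \<le> 0\<close>.

  The convex combination with weights \<open>p\<close> and \<open>1 - p\<close> is
  \<open>f d_bar + \<mu> S \<le> p * f d_star + \<mu> p \<Delta>\<close>, and the terms in \<open>\<mu>\<close> cancel in the right direction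
  because \<open>S \<ge> p \<Delta>\<close> and \<open>\<mu> \<ge> 0\<close>.
\<close>

text \<open>
  The smallest admissible slacks for \<open>d\<close> are the absolute values that they bound; with this choice
  the Lagrangian is the objective, shifted by \<open>C\<close>, plus a multiple of the excess of the 1-norm over \<open>\<Delta>\<close>.
\<close>

definition tight_lift :: "(nat \<Rightarrow> nat \<Rightarrow> int) \<Rightarrow> mat \<Rightarrow> mat \<times> mat \<times> mat \<times> mat" where
  "tight_lift x d =
     (d, \<lambda>i j. \<bar>d i j\<bar>,
      \<lambda>i j. \<bar>x (i+1) j + d (i+1) j - x i j - d i j\<bar>,
      \<lambda>i j. \<bar>x i (j+1) + d i (j+1) - x i j - d i j\<bar>)"

lemma lagrangian_tight_lift:
  "lagrangian N M c \<alpha> \<Delta> \<mu> (tight_lift x d) =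
     og_objective N M x c \<alpha> d + C_bar N M x \<alpha> + \<mu> * ((\<Sum>i=1..N. \<Sum>j=1..M. \<bar>d i j\<bar>) - \<Delta>)"
  by (simp add: lagrangian_def tight_lift_def og_objective_def mat_inner_def omega_def distrib_left)

text \<open>
  Conversely, slacks that are not tight do no better: \<open>\<beta>\<close> and \<open>\<gamma>\<close> dominate the absolute differences
  in \<open>\<omega>(d)\<close> and enter with a nonnegative weight. The slacks \<open>\<delta>\<close> are left as they are.
\<close>

lemma objective_le_lagrangian:
  assumes "(d, \<delta>, \<beta>, \<gamma>) \<in> P_poly N M \<Xi> x" and "\<alpha> \<ge> 0"
  shows "og_objective N M x c \<alpha> d + C_bar N M x \<alpha> + \<mu> * ((\<Sum>i=1..N. \<Sum>j=1..M. \<delta> i j) - \<Delta>)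
       \<le> lagrangian N M c \<alpha> \<Delta> \<mu> (d, \<delta>, \<beta>, \<gamma>)"
proof -
  have "\<bar>x (i+1) j + d (i+1) j - x i j - d i j\<bar> \<le> \<beta> i j" if "i \<in> {1..N-1}" "j \<in> {1..M}" for i j
  proof -
    have "- \<beta> i j \<le> x (i+1) j + d (i+1) j - x i j - d i j \<and>
          x (i+1) j + d (i+1) j - x i j - d i j \<le> \<beta> i j"
      using assms(1) that unfolding P_poly_def by blast
    then show ?thesis by linarith
  qed
  then have "(\<Sum>j=1..M. \<Sum>i=1..N-1. \<bar>x (i+1) j + d (i+1) j - x i j - d i j\<bar>)
      \<le> (\<Sum>j=1..M. \<Sum>i=1..N-1. \<beta> i j)"
    by (intro sum_mono)
  moreover have "\<bar>x i (j+1) + d i (j+1) - x i j - d i j\<bar> \<le> \<gamma> i j" if "i \<in> {1..N}" "j \<in> {1..M-1}" for i j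
  proof -
    have "- \<gamma> i j \<le> x i (j+1) + d i (j+1) - x i j - d i j \<and>
          x i (j+1) + d i (j+1) - x i j - d i j \<le> \<gamma> i j"
      using assms(1) that unfolding P_poly_def by blast
    then show ?thesis by linarith
  qed
  then have "(\<Sum>i=1..N. \<Sum>j=1..M-1. \<bar>x i (j+1) + d i (j+1) - x i j - d i j\<bar>)
      \<le> (\<Sum>i=1..N. \<Sum>j=1..M-1. \<gamma> i j)"
    by (intro sum_mono)
  ultimately have "omega N M x \<alpha> d
      \<le> \<alpha> * ((\<Sum>j=1..M. \<Sum>i=1..N-1. \<beta> i j) + (\<Sum>i=1..N. \<Sum>j=1..M-1. \<gamma> i j))"
    unfolding omega_def distrib_left[symmetric]
    by (intro mult_left_mono add_mono \<open>\<alpha> \<ge> 0\<close>)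
  then show ?thesis
    by (simp add: lagrangian_def og_objective_def mat_inner_def)
qed

lemma tight_lift_feasible:
  assumes "finite \<Xi>" and "integral_mat N M d"
    and "\<And>i j. i \<in> {1..N} \<Longrightarrow> j \<in> {1..M} \<Longrightarrow> x i j + d i j \<in> real_of_int ` \<Xi>"
  shows "tight_lift x d \<in> lr_feasible N M \<Xi> x"
proof -
  have "Min \<Xi> \<le> x i j + d i j \<and> x i j + d i j \<le> Max \<Xi>"
    if "i \<in> {1..N}" "j \<in> {1..M}" for i j
    using assms(3)[OF that] assms(1) by auto
  then show ?thesis
    using assms(2) by (auto simp: tight_lift_def lr_feasible_def P_poly_def)
qed

text \<open>
  The constant \<open>C - \<mu> \<Delta>\<close> is common to both sides of the inequality between Lagrangian values and
  drops out. The left-hand side keeps the slacks \<open>\<delta>\<close> themselves: the 1-norm of \<open>d\<close> could be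
  smaller, whereas the hypothesis of the approximation bound concerns the sum of \<open>\<delta>\<close>.
\<close>

lemma lagrangian_minimiser_bound:
  assumes "is_arg_min (lagrangian N M c \<alpha> \<Delta> \<mu>) (\<lambda>t. t \<in> lr_feasible N M \<Xi> x) (d, \<delta>, \<beta>, \<gamma>)"
    and "\<alpha> \<ge> 0" and "finite \<Xi>" and "integral_mat N M e"
    and "\<And>i j. i \<in> {1..N} \<Longrightarrow> j \<in> {1..M} \<Longrightarrow> x i j + e i j \<in> real_of_int ` \<Xi>"
  shows "og_objective N M x c \<alpha> d + \<mu> * (\<Sum>i=1..N. \<Sum>j=1..M. \<delta> i j)
       \<le> og_objective N M x c \<alpha> e + \<mu> * (\<Sum>i=1..N. \<Sum>j=1..M. \<bar>e i j\<bar>)"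
proof -
  have feasible: "(d, \<delta>, \<beta>, \<gamma>) \<in> P_poly N M \<Xi> x"
    using assms(1) by (auto simp: is_arg_min_linorder lr_feasible_def)
  have "lagrangian N M c \<alpha> \<Delta> \<mu> (d, \<delta>, \<beta>, \<gamma>) \<le> lagrangian N M c \<alpha> \<Delta> \<mu> (tight_lift x e)"
    using assms(1) tight_lift_feasible[OF assms(3-5)]
    by (simp add: is_arg_min_linorder del: split_paired_All)
  from order_trans[OF objective_le_lagrangian[OF feasible \<open>\<alpha> \<ge> 0\<close>] this]
  show ?thesis
    by (simp add: lagrangian_tight_lift right_diff_distrib)
qed

lemma og_objective_zero: "og_objective N M x c \<alpha> (\<lambda>_ _. 0) = 0"
  by (simp add: og_objective_def mat_inner_def omega_def C_bar_def)

theorem theorem2: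
  fixes N M \<Delta> :: nat and \<Xi> :: "int set" and x :: "nat \<Rightarrow> nat \<Rightarrow> int"
    and c :: "nat \<Rightarrow> nat \<Rightarrow> real" and \<alpha> p \<mu>_bar :: real
    and d_bar \<delta>_bar \<beta>_bar \<gamma>_bar d_star :: "nat \<Rightarrow> nat \<Rightarrow> real"
  assumes "finite \<Xi>" and "\<Xi> \<noteq> {}" and "contiguous \<Xi>"
    and "\<And>i j. i \<in> {1..N} \<Longrightarrow> j \<in> {1..M} \<Longrightarrow> x i j \<in> \<Xi>"
    and "\<alpha> > 0"
    and "lr_optimal N M \<Xi> x c \<alpha> \<Delta> d_bar \<delta>_bar \<beta>_bar \<gamma>_bar \<mu>_bar"
    and "og_optimal N M \<Xi> x c \<alpha> \<Delta> d_star"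
    and "0 < p" and "p \<le> 1"
    and "real \<Delta> \<ge> (\<Sum>i=1..N. \<Sum>j=1..M. \<delta>_bar i j)"
    and "(\<Sum>i=1..N. \<Sum>j=1..M. \<delta>_bar i j) \<ge> p * real \<Delta>"
  shows "mat_inner N M c d_bar + omega N M x \<alpha> d_bar - C_bar N M x \<alpha>
       \<le> p * (mat_inner N M c d_star + omega N M x \<alpha> d_star - C_bar N M x \<alpha>)"
proof -
  let ?f = "og_objective N M x c \<alpha>"
  let ?S = "\<Sum>i=1..N. \<Sum>j=1..M. \<delta>_bar i j"
  have \<mu>: "\<mu>_bar \<ge> 0"
    and min: "is_arg_min (lagrangian N M c \<alpha> \<Delta> \<mu>_bar) (\<lambda>t. t \<in> lr_feasible N M \<Xi> x)
                (d_bar, \<delta>_bar, \<beta>_bar, \<gamma>_bar)"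
    using assms(6) by (auto simp: lr_optimal_def is_arg_max_def)
  note bound = lagrangian_minimiser_bound[OF min less_imp_le[OF \<open>\<alpha> > 0\<close>] \<open>finite \<Xi>\<close>]
  have star: "og_feasible N M \<Xi> x \<Delta> d_star"
    using assms(7) by (simp add: og_optimal_def is_arg_min_def)
  have "?f d_bar + \<mu>_bar * ?S \<le> ?f d_star + \<mu>_bar * (\<Sum>i=1..N. \<Sum>j=1..M. \<bar>d_star i j\<bar>)"
    using star by (intro bound) (auto simp: og_feasible_def)
  also have "\<dots> \<le> ?f d_star + \<mu>_bar * \<Delta>"
    using star \<mu> by (intro add_left_mono mult_left_mono) (auto simp: og_feasible_def)
  finally have vs_star: "?f d_bar + \<mu>_bar * ?S \<le> ?f d_star + \<mu>_bar * \<Delta>" .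
  have "?f d_bar + \<mu>_bar * ?S
      \<le> ?f (\<lambda>_ _. 0) + \<mu>_bar * (\<Sum>i=1..N. \<Sum>j=1..M. \<bar>(\<lambda>_ _. 0 :: real) i j\<bar>)"
    using assms(4) by (intro bound) (auto simp: integral_mat_def)
  then have vs_zero: "?f d_bar + \<mu>_bar * ?S \<le> 0"
    by (simp add: og_objective_zero)
  have "?f d_bar + \<mu>_bar * ?S
      = p * (?f d_bar + \<mu>_bar * ?S) + (1 - p) * (?f d_bar + \<mu>_bar * ?S)"
    by (simp add: algebra_simps)
  also have "\<dots> \<le> p * (?f d_star + \<mu>_bar * \<Delta>) + (1 - p) * 0"
    using \<open>0 < p\<close> \<open>p \<le> 1\<close> by (intro add_mono mult_left_mono vs_star vs_zero) auto
  also have "\<dots> = p * ?f d_star + \<mu>_bar * (p * \<Delta>)"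
    by (simp add: algebra_simps)
  also have "\<dots> \<le> p * ?f d_star + \<mu>_bar * ?S"
    using assms(11) \<mu> by (intro add_left_mono mult_left_mono)
  finally show ?thesis
    by (simp add: og_objective_def)
qed

end
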